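(* Assume the following hypothesis holds: for every rational number $0<\theta\le 1$ there exists an integer $n_0=n_0(\theta)$ such that for all $n\ge n_0+1$, \[ R_n(\theta)=R_{n_0}(\theta)+R_{n-n_0}\bigl(\theta-R_{n_0}(\theta)\bigr), \] and the best $(n-n_0)$-term Egyptian underapproximation of $\theta-R_{n_0}(\theta)$ is always the one constructed by the greedy algorithm. Let $0<\lambda\le 1$ be a rational number whose best $m$-term Egyptian underapproximation is unique for every positive integer $m$. Let $\{u_n\}_{n=1}^\infty$ be the best Egyptian underapproximation of $\lambda$, and let $\{a_n\}_{n=1}^\infty$ be an eventually Sylvester sequence of positive integers satisfying $\sum_{i=1}^\infty \frac{1}{a_i}=\lambda$. If $\{a_n\}$ and $\{u_n\}$ are distinct as sets, then \[ \liminf_{n\to\infty} a_n^{1/2^n}=\lim_{n\to\infty} a_n^{1/2^n} < \lim_{n\to\infty} u_n^{1/2^n}. \]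
   Context: An $n$-term Egyptian underapproximation of a rational $0<\lambda\le1$ is a sequence of positive integers $x_1\le\cdots\le x_n$ with $\sum_{i=1}^n 1/x_i<\lambda$; the best one maximizes this sum and $R_n(\lambda)$ denotes the maximal sum. The greedy one is defined by $x_i=\lfloor(\lambda-\sum_{j<i}1/x_j)^{-1}\rfloor+1$. When the best $m$-term underapproximation is unique for all $m$, the best Egyptian underapproximation $\{u_n\}$ is the infinite sequence whose first $m$ terms form the best $m$-term underapproximation for each $m$. A sequence $\{a_n\}$ of positive integers is eventually Sylvester if there is $N>0$ with $a_{n+1}=a_n^2-a_n+1$ for all $n\ge N$. *)

theory Defs
  imports Complex_Main "HOL-Library.Extended_Real"
begin

text \<open>
  Infinite sequences are indexed from 1: a sequence is a function on \<^typ>\<open>nat\<close>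
  whose value at 0 is never used.
\<close>

definition recip_sum :: "nat list \<Rightarrow> real" where
  "recip_sum xs = (\<Sum>x\<leftarrow>xs. 1 / real x)"

definition egyptian_underapprox :: "nat \<Rightarrow> real \<Rightarrow> nat list \<Rightarrow> bool" where
  "egyptian_underapprox n \<theta> xs \<longleftrightarrow>
     length xs = n \<and> sorted xs \<and> (\<forall>x\<in>set xs. 0 < x) \<and> recip_sum xs < \<theta>"

definition best_underapprox :: "nat \<Rightarrow> real \<Rightarrow> nat list \<Rightarrow> bool" where
  "best_underapprox n \<theta> xs \<longleftrightarrow>
     egyptian_underapprox n \<theta> xs \<and>
     (\<forall>ys. egyptian_underapprox n \<theta> ys \<longrightarrow> recip_sum ys \<le> recip_sum xs)"

text \<open>
  For \<open>\<theta> > 0\<close> the maximum exists for every \<open>n\<close>; in particular \<open>R 0 \<theta> = 0\<close>.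
\<close>

definition R :: "nat \<Rightarrow> real \<Rightarrow> real" where
  "R n \<theta> = (GREATEST s. \<exists>xs. egyptian_underapprox n \<theta> xs \<and> s = recip_sum xs)"

primrec greedy_underapprox :: "nat \<Rightarrow> real \<Rightarrow> nat list" where
  "greedy_underapprox 0 \<theta> = []"
| "greedy_underapprox (Suc n) \<theta> =
     greedy_underapprox n \<theta> @
       [nat (\<lfloor>inverse (\<theta> - recip_sum (greedy_underapprox n \<theta>))\<rfloor> + 1)]"

definition best_egyptian_underapprox :: "real \<Rightarrow> (nat \<Rightarrow> nat) \<Rightarrow> bool" where
  "best_egyptian_underapprox \<theta> u \<longleftrightarrow>
     (\<forall>m\<ge>1. best_underapprox m \<theta> (map u [1..<m + 1]))"

text \<open>The subtraction on \<^typ>\<open>nat\<close> never truncates, since \<open>k \<le> k\<^sup>2\<close>.\<close>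

definition eventually_sylvester :: "(nat \<Rightarrow> nat) \<Rightarrow> bool" where
  "eventually_sylvester a \<longleftrightarrow> (\<exists>N>0. \<forall>n\<ge>N. a (n + 1) = (a n)\<^sup>2 - a n + 1)"

end

theory Submission
  imports Defs "HOL-Library.Multiset"
begin

text \<open>
  Past \<open>n0\<close> the hypothesis makes \<open>u\<close> greedy. The numerators of the remainders of a rational
  number under the greedy algorithm do not increase, so at a minimal numerator the remainder is a
  unit fraction \<open>1 / (u (n + 1) - 1)\<close>, and from there on \<open>u\<close> is Sylvester. The tail
  of the series of \<open>a\<close> telescopes to \<open>1 / (a (n + 1) - 1)\<close> in the same way, so optimality of
  \<open>u\<close> gives \<open>a n \<le> u n\<close> for large \<open>n\<close>, and equality at one index would, by
  uniqueness, make the two initial segments permutations of each other and the two tails equal.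
  Hence \<open>a n \<le> u n - 1\<close>. Finally, a Sylvester sequence \<open>w\<close> satisfies
  \<open>(w n - 1)\<^sup>2 \<le> w (n + 1) - 1\<close> and \<open>w (n + 1) < (w n)\<^sup>2\<close>, so that
  \<open>(w n - 1) powr (1 / 2 ^ n) \<le> lim < w n powr (1 / 2 ^ n)\<close>, which separates the two limits.
\<close>

section \<open>Reciprocal sums, \<open>R\<close> and the greedy recursion\<close>

lemma recip_sum_map_upt: "recip_sum (map w [1..<m + 1]) = (\<Sum>i<m. 1 / real (w (i + 1)))"
  by (induction m) (auto simp: recip_sum_def)

lemma recip_sum_sort: "recip_sum (sort xs) = recip_sum xs"
proof -
  have "mset (map (\<lambda>x. 1 / real x) (sort xs)) = mset (map (\<lambda>x. 1 / real x) xs)"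
    by simp
  then show ?thesis
    unfolding recip_sum_def by (metis sum_mset_sum_list)
qed

lemma R_eq_recip_sum:
  assumes "best_underapprox n \<theta> xs"
  shows "R n \<theta> = recip_sum xs"
  unfolding R_def using assms by (intro Greatest_equality) (auto simp: best_underapprox_def)

lemma R_0:
  assumes "0 < \<theta>"
  shows "R 0 \<theta> = 0"
proof -
  have "best_underapprox 0 \<theta> []"
    using assms by (auto simp: best_underapprox_def egyptian_underapprox_def recip_sum_def)
  from R_eq_recip_sum[OF this] show ?thesis by (simp add: recip_sum_def)
qed

text \<open>While the remainder is positive the floor is nonnegative, so the conversion
  \<open>nat\<close> in \<open>greedy_underapprox\<close> loses nothing.\<close>

lemma recip_sum_greedy_Suc:
  assumes "recip_sum (greedy_underapprox n \<theta>) < \<theta>"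
  shows "recip_sum (greedy_underapprox (Suc n) \<theta>) = recip_sum (greedy_underapprox n \<theta>)
    + 1 / (of_int \<lfloor>inverse (\<theta> - recip_sum (greedy_underapprox n \<theta>))\<rfloor> + 1)"
proof -
  have "0 \<le> \<lfloor>inverse (\<theta> - recip_sum (greedy_underapprox n \<theta>))\<rfloor>"
    using assms by simp
  then show ?thesis
    by (simp add: recip_sum_def)
qed

section \<open>Greedy remainders of rational numbers\<close>

text \<open>If \<open>r n = p / q\<close>, the choice of \<open>x n\<close> gives
  \<open>0 < p * x n - q \<le> p\<close>, and \<open>p * x n - q\<close> is a numerator of the next
  remainder over \<open>q * x n\<close>. For the least numerator \<open>p\<close> equality must
  hold, so \<open>q = p * (x n - 1)\<close>, and \<open>p\<close> remains a numerator.\<close>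

lemma greedy_remainder_eventually_unit_fraction:
  fixes r :: "nat \<Rightarrow> real" and x :: "nat \<Rightarrow> nat"
  assumes rat: "r n0 \<in> \<rat>"
    and pos: "\<And>n. n \<ge> n0 \<Longrightarrow> 0 < r n"
    and x: "\<And>n. n \<ge> n0 \<Longrightarrow> real (x n) = of_int \<lfloor>inverse (r n)\<rfloor> + 1"
    and step: "\<And>n. n \<ge> n0 \<Longrightarrow> r (Suc n) = r n - 1 / real (x n)"
  shows "\<exists>N\<ge>n0. \<forall>n\<ge>N. r n = 1 / (real (x n) - 1)"
proof -
  \<comment> \<open>Fractions need not be in lowest terms, so no gcd has to be tracked when a new
    numerator is formed.\<close>
  define P where "P p \<longleftrightarrow> (\<exists>n\<ge>n0. \<exists>q::nat. 0 < q \<and> r n = real p / real q)" for p :: nat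
  obtain p' q' :: nat where "q' \<noteq> 0" "\<bar>r n0\<bar> = real p' / real q'"
    using Rats_abs_nat_div_natE[OF rat] by metis
  then have "P p'"
    unfolding P_def using pos[of n0] by (intro exI[of _ n0]) auto
  define p where "p = (LEAST p. P p)"
  have Pp: "P p" and min: "\<And>p'. P p' \<Longrightarrow> p \<le> p'"
    unfolding p_def using \<open>P p'\<close> by (auto intro: LeastI Least_le)
  have next_numerator: "real q = real p * (real (x n) - 1)"
      "\<exists>q'::nat. 0 < q' \<and> r (Suc n) = real p / real q'"
    if n: "n \<ge> n0" and q: "0 < q" "r n = real p / real q" for n q
  proof -
    have p: "0 < p" using pos[OF n] q by (cases "p = 0") auto
    have inv: "inverse (r n) = real q / real p" using q by simp
    have "real (x n) > real q / real p" "real (x n) - 1 \<le> real q / real p"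
      using x[OF n] inv by linarith+
    then have lo: "real q < real p * real (x n)" and hi: "real p * real (x n) - real q \<le> real p"
      using p by (auto simp: field_simps)
    have x_pos: "0 < x n" using lo by (auto intro: gr0I)
    define p2 where "p2 = p * x n - q"
    have "q < p * x n" using lo by (metis of_nat_less_iff of_nat_mult)
    then have p2: "real p2 = real p * real (x n) - real q"
      unfolding p2_def by (simp add: of_nat_diff)
    have r2: "r (Suc n) = real p2 / real (q * x n)"
      unfolding step[OF n] q(2) p2 using q x_pos by (simp add: field_simps)
    have "P p2"
      unfolding P_def using n q x_pos r2 by (intro exI[of _ "Suc n"] conjI exI[of _ "q * x n"]) auto
    then have "p2 = p"
      using min[of p2] hi p2 by simp
    then show "real q = real p * (real (x n) - 1)"
      using p2 by (simp add: algebra_simps)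
    show "\<exists>q'::nat. 0 < q' \<and> r (Suc n) = real p / real q'"
      using r2 \<open>p2 = p\<close> q x_pos by (intro exI[of _ "q * x n"]) auto
  qed
  obtain N q where N: "N \<ge> n0" "0 < q" "r N = real p / real q"
    using Pp unfolding P_def by blast
  have frac: "\<exists>q::nat. 0 < q \<and> r n = real p / real q" if "n \<ge> N" for n
    using that
  proof (induction n rule: dec_induct)
    case base
    then show ?case using N by blast
  next
    case (step n)
    then show ?case using next_numerator(2)[of n] N(1) by (meson le_trans)
  qed
  have "r n = 1 / (real (x n) - 1)" if "n \<ge> N" for n
  proof -
    obtain q where q: "0 < q" "r n = real p / real q" using frac[OF \<open>n \<ge> N\<close>] by blast
    have "n \<ge> n0" using that N(1) by simp
    have "p \<noteq> 0" using pos[OF \<open>n \<ge> n0\<close>] q by (cases "p = 0") simp_all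
    then show ?thesis
      using q next_numerator(1)[OF \<open>n \<ge> n0\<close> q] by simp
  qed
  then show ?thesis using N(1) by blast
qed

text \<open>Subtracting \<open>1 / x\<close> from the unit fraction \<open>1 / (x - 1)\<close>
  leaves \<open>1 / (x * (x - 1))\<close>; this must be \<open>1 / (x' - 1)\<close> for the next
  term \<open>x'\<close>.\<close>

lemma greedy_remainder_eventually_sylvester:
  fixes r :: "nat \<Rightarrow> real" and x :: "nat \<Rightarrow> nat"
  assumes rat: "r n0 \<in> \<rat>"
    and pos: "\<And>n. n \<ge> n0 \<Longrightarrow> 0 < r n"
    and x: "\<And>n. n \<ge> n0 \<Longrightarrow> real (x n) = of_int \<lfloor>inverse (r n)\<rfloor> + 1"
    and step: "\<And>n. n \<ge> n0 \<Longrightarrow> r (Suc n) = r n - 1 / real (x n)"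
  obtains N where "N \<ge> n0" "\<And>n. n \<ge> N \<Longrightarrow> r n = 1 / (real (x n) - 1)"
    "\<And>n. n \<ge> N \<Longrightarrow> 2 \<le> x n" "\<And>n. n \<ge> N \<Longrightarrow> x (Suc n) = (x n)\<^sup>2 - x n + 1"
proof -
  obtain N where N: "N \<ge> n0" and unit: "\<And>n. n \<ge> N \<Longrightarrow> r n = 1 / (real (x n) - 1)"
    using greedy_remainder_eventually_unit_fraction[of r n0 x, OF assms] by blast
  have ge2: "2 \<le> x n" if "n \<ge> N" for n
  proof -
    have "0 < 1 / (real (x n) - 1)" using pos[of n] unit[OF that] that N by simp
    then have "real (x n) > 1" by (simp add: zero_less_divide_iff)
    then show ?thesis by simp
  qed
  have "x (Suc n) = (x n)\<^sup>2 - x n + 1" if n: "n \<ge> N" for n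
  proof -
    have "1 / (real (x (Suc n)) - 1) = 1 / (real (x n) - 1) - 1 / real (x n)"
      using unit[of "Suc n"] unit[OF n] step[of n] n N by simp
    also have "\<dots> = 1 / (real (x n) * (real (x n) - 1))"
      using ge2[OF n] by (simp add: field_simps)
    finally have "real (x (Suc n)) = real (x n) * (real (x n) - 1) + 1"
      by simp
    also have "\<dots> = real ((x n)\<^sup>2 - x n + 1)"
      by (simp add: of_nat_diff power2_eq_square algebra_simps)
    finally show ?thesis by linarith
  qed
  then show ?thesis using that N unit ge2 by blast
qed

section \<open>Tails of convergent Sylvester series\<close>

lemma sylvester_tail:
  fixes a :: "nat \<Rightarrow> nat"
  assumes pos: "\<forall>n\<ge>1. 0 < a n"
    and N: "N > 0" "\<And>n. n \<ge> N \<Longrightarrow> a (n + 1) = (a n)\<^sup>2 - a n + 1"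
    and sums: "(\<lambda>i. 1 / real (a (i + 1))) sums s"
    and n: "n \<ge> N"
  shows "2 \<le> a n" "s - (\<Sum>i<n. 1 / real (a (i + 1))) = 1 / (real (a (n + 1)) - 1)"
proof -
  have lim0: "(\<lambda>i. 1 / real (a (i + 1))) \<longlonglongrightarrow> 0"
    using sums by (intro summable_LIMSEQ_zero) (auto simp: sums_iff)
  \<comment> \<open>The value 1 is a fixed point of the recursion; it would keep the summands at 1,
    although they tend to 0.\<close>
  have ge2: "2 \<le> a k" if k: "k \<ge> N" for k
  proof (rule ccontr)
    assume "\<not> 2 \<le> a k"
    then have "a k = 1" using pos k N(1) by (metis One_nat_def Suc_1 Suc_leI le_trans less_2_cases
      not_le less_numeral_extra(3))
    have one: "a j = 1" if "j \<ge> k" for j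
      using that
    proof (induction j rule: dec_induct)
      case (step j)
      then show ?case using N(2)[of j] k by simp
    qed (fact \<open>a k = 1\<close>)
    have "eventually (\<lambda>i. 1 / real (a (i + 1)) = 1) sequentially"
      using one by (auto simp: eventually_sequentially intro!: exI[of _ k])
    then have "(\<lambda>i. 1 / real (a (i + 1))) \<longlonglongrightarrow> 1"
      by (rule tendsto_eventually)
    then show False using lim0 LIMSEQ_unique by fastforce
  qed
  then show "2 \<le> a n" using n .
  \<comment> \<open>The partial sum plus the expected tail: constant from \<open>N\<close> on by the
    identity \<open>1 / (x - 1) = 1 / x + 1 / (x * (x - 1))\<close>, and convergent to
    \<open>s\<close> because the second summand vanishes in the limit.\<close>
  define T where "T k = (\<Sum>i<k. 1 / real (a (i + 1))) + 1 / (real (a (k + 1)) - 1)" for k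
  have T_Suc: "T (Suc k) = T k" if "k \<ge> N" for k
  proof -
    have "a (k + 2) = (a (k + 1))\<^sup>2 - a (k + 1) + 1" using N(2)[of "k + 1"] that by simp
    then have "real (a (k + 2)) - 1 = real (a (k + 1)) * (real (a (k + 1)) - 1)"
      by (simp add: of_nat_diff power2_eq_square algebra_simps)
    moreover have "2 \<le> real (a (k + 1))" using ge2[of "k + 1"] that by simp
    ultimately have "1 / (real (a (k + 1)) - 1) = 1 / real (a (k + 1)) + 1 / (real (a (k + 2)) - 1)"
      by (simp add: divide_simps)
    then show ?thesis unfolding T_def by simp
  qed
  have T_const: "T k = T n" if "k \<ge> n" for k
    using that
  proof (induction k rule: dec_induct)
    case (step k)
    then show ?case using T_Suc[of k] n by simp
  qed simp
  have "(\<lambda>k. 1 / (real (a (k + 1)) - 1)) \<longlonglongrightarrow> 0"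
  proof (rule tendsto_sandwich[of "\<lambda>_. 0" _ _ "\<lambda>k. 2 * (1 / real (a (k + 1)))"])
    have ge: "2 \<le> real (a (k + 1))" if "k \<ge> N" for k using ge2[of "k + 1"] that by simp
    show "eventually (\<lambda>k. 0 \<le> 1 / (real (a (k + 1)) - 1)) sequentially"
      unfolding eventually_sequentially using ge by (intro exI[of _ N]) force
    show "eventually (\<lambda>k. 1 / (real (a (k + 1)) - 1) \<le> 2 * (1 / real (a (k + 1)))) sequentially"
      unfolding eventually_sequentially
    proof (intro exI[of _ N] allI impI)
      fix k assume "k \<ge> N"
      from ge[OF this] show "1 / (real (a (k + 1)) - 1) \<le> 2 * (1 / real (a (k + 1)))"
        by (simp add: field_simps)
    qed
    show "(\<lambda>k. 2 * (1 / real (a (k + 1)))) \<longlonglongrightarrow> 0"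
      using tendsto_mult_left[OF lim0, of 2] by simp
  qed simp
  moreover have "(\<lambda>k. \<Sum>i<k. 1 / real (a (i + 1))) \<longlonglongrightarrow> s"
    using sums by (simp add: sums_def)
  ultimately have "T \<longlonglongrightarrow> s"
    unfolding T_def using tendsto_add by fastforce
  moreover have "T \<longlonglongrightarrow> T n"
    by (rule tendsto_eventually) (auto simp: eventually_sequentially intro!: exI[of _ n] T_const)
  ultimately have "T n = s" by (rule LIMSEQ_unique[symmetric])
  then show "s - (\<Sum>i<n. 1 / real (a (i + 1))) = 1 / (real (a (n + 1)) - 1)"
    unfolding T_def by simp
qed

section \<open>Growth of Sylvester sequences\<close>

lemma square_powr_half_power:
  assumes "0 \<le> (y::real)"
  shows "(y\<^sup>2) powr (1 / 2 ^ Suc n) = y powr (1 / 2 ^ n)"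
proof (cases "y = 0")
  case False
  with assms have "y\<^sup>2 = y powr 2" by simp
  then show ?thesis by (simp add: powr_powr)
qed simp

text \<open>After taking roots, \<open>w n\<close> gives a strictly decreasing sequence and
  \<open>w n - 1\<close> a nondecreasing one below it. The two bounds on \<open>l\<close> let a gap
  of 1 at one index separate the limits of two sequences.\<close>

lemma sylvester_growth:
  fixes w :: "nat \<Rightarrow> nat"
  assumes N: "\<And>n. n \<ge> N \<Longrightarrow> w (n + 1) = (w n)\<^sup>2 - w n + 1"
    and ge2: "\<And>n. n \<ge> N \<Longrightarrow> 2 \<le> w n"
  obtains l where "(\<lambda>n. real (w n) powr (1 / 2 ^ n)) \<longlonglongrightarrow> l"
    "\<And>n. n \<ge> N \<Longrightarrow> (real (w n) - 1) powr (1 / 2 ^ n) \<le> l"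
    "\<And>n. n \<ge> N \<Longrightarrow> l < real (w n) powr (1 / 2 ^ n)"
proof -
  define f where "f n = real (w n) powr (1 / 2 ^ n)" for n
  define g where "g n = (real (w n) - 1) powr (1 / 2 ^ n)" for n
  have ge: "2 \<le> real (w n)" if "n \<ge> N" for n using ge2[OF that] by simp
  have rec: "real (w (Suc n)) = (real (w n))\<^sup>2 - real (w n) + 1" if "n \<ge> N" for n
    using N[OF that] by (simp add: of_nat_diff power2_eq_square)
  have f_dec: "f (Suc n) < f n" if "n \<ge> N" for n
  proof -
    have "f (Suc n) < ((real (w n))\<^sup>2) powr (1 / 2 ^ Suc n)"
      unfolding f_def using rec[OF that] ge[OF that] ge[of "Suc n"] that
      by (intro powr_less_mono2) auto
    then show ?thesis unfolding f_def by (simp only: square_powr_half_power of_nat_0_le_iff)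
  qed
  have g_inc: "g n \<le> g (Suc n)" if "n \<ge> N" for n
  proof -
    have "0 \<le> real (w n) - 1" using ge[OF that] by simp
    then have "g n = ((real (w n) - 1)\<^sup>2) powr (1 / 2 ^ Suc n)"
      unfolding g_def by (simp only: square_powr_half_power)
    also have "\<dots> \<le> g (Suc n)"
      unfolding g_def using rec[OF that] ge[OF that]
        zero_le_power2[of "real (w n) - 1"]
      by (intro powr_mono2) (simp_all add: power2_diff)
    finally show ?thesis .
  qed
  have dec: "decseq (\<lambda>k. f (k + N))"
    unfolding decseq_Suc_iff using f_dec by (simp add: less_imp_le)
  obtain l where lim: "(\<lambda>k. f (k + N)) \<longlonglongrightarrow> l" and le: "\<And>k. l \<le> f (k + N)"
    using decseq_convergent[OF dec, of 0] unfolding f_def by (metis powr_ge_zero)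
  then have lim: "f \<longlonglongrightarrow> l" by (simp add: LIMSEQ_offset)
  have "g n \<le> l" if "n \<ge> N" for n
  proof (rule LIMSEQ_le_const[OF lim], intro exI[of _ n] allI impI)
    fix m assume "m \<ge> n"
    then have "g n \<le> g m"
    proof (induction m rule: dec_induct)
      case (step m)
      then show ?case using g_inc[of m] that by simp
    qed simp
    also have "g m \<le> f m"
      unfolding f_def g_def using ge[of m] that \<open>m \<ge> n\<close> by (intro powr_mono2) auto
    finally show "g n \<le> f m" .
  qed
  \<comment> \<open>Strictness comes from going one index further:
    \<open>l \<le> f (Suc n) < f n\<close>.\<close>
  moreover have "l < f n" if "n \<ge> N" for n
    using le[of "Suc n - N"] f_dec[OF that] that by (simp add: Suc_diff_le)
  ultimately show ?thesis
    using that lim unfolding f_def g_def by blast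
qed

section \<open>Comparison of the two sequences\<close>

theorem theorem1p11:
  fixes lam :: real and u a :: "nat \<Rightarrow> nat"
  assumes hypothesis:
    "\<forall>\<theta>\<in>\<rat>. 0 < \<theta> \<and> \<theta> \<le> 1 \<longrightarrow>
       (\<exists>n0. \<forall>n\<ge>n0 + 1.
          R n \<theta> = R n0 \<theta> + R (n - n0) (\<theta> - R n0 \<theta>) \<and>
          best_underapprox (n - n0) (\<theta> - R n0 \<theta>)
            (greedy_underapprox (n - n0) (\<theta> - R n0 \<theta>)))"
    and lam: "lam \<in> \<rat>" "0 < lam" "lam \<le> 1"
    and unique: "\<forall>m\<ge>1. \<exists>!xs. best_underapprox m lam xs"
    and u: "best_egyptian_underapprox lam u"
    and a_pos: "\<forall>n\<ge>1. 0 < a n"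
    and a_sylvester: "eventually_sylvester a"
    and a_sum: "(\<lambda>i. 1 / real (a (i + 1))) sums lam"
    and distinct_sets: "a ` {1..} \<noteq> u ` {1..}"
  shows "convergent (\<lambda>n. real (a n) powr (1 / 2 ^ n)) \<and>
         convergent (\<lambda>n. real (u n) powr (1 / 2 ^ n)) \<and>
         liminf (\<lambda>n. ereal (real (a n) powr (1 / 2 ^ n))) =
           ereal (lim (\<lambda>n. real (a n) powr (1 / 2 ^ n))) \<and>
         lim (\<lambda>n. real (a n) powr (1 / 2 ^ n)) < lim (\<lambda>n. real (u n) powr (1 / 2 ^ n))"
proof -
  define S where "S w n = (\<Sum>i<n. 1 / real (w (i + 1)))" for w :: "nat \<Rightarrow> nat" and n
  have S_Suc: "S w (Suc n) = S w n + 1 / real (w (n + 1))" for w n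
    unfolding S_def by simp
  have best: "best_underapprox m lam (map u [1..<m + 1])" if "m \<ge> 1" for m
    using u that unfolding best_egyptian_underapprox_def by blast
  \<comment> \<open>The case \<open>m = 0\<close> matters because \<open>n0\<close> may be
    0.\<close>
  have R_u: "R m lam = S u m" for m
  proof (cases m)
    case 0
    then show ?thesis using R_0[OF lam(2)] by (simp add: S_def)
  next
    case (Suc k)
    then show ?thesis using R_eq_recip_sum[OF best[of m]] recip_sum_map_upt[of u m]
      by (simp add: S_def)
  qed
  have S_u_less: "S u m < lam" for m
    using best[of m] lam recip_sum_map_upt[of u m]
    by (cases "m = 0") (auto simp: S_def best_underapprox_def egyptian_underapprox_def)

  obtain n0 where n0: "\<And>n. n \<ge> n0 + 1 \<Longrightarrow> R n lam = R n0 lam + R (n - n0) (lam - R n0 lam)"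
      "\<And>n. n \<ge> n0 + 1 \<Longrightarrow>
        best_underapprox (n - n0) (lam - R n0 lam) (greedy_underapprox (n - n0) (lam - R n0 lam))"
    using hypothesis lam by blast
  define \<mu> where "\<mu> = lam - S u n0"
  define G where "G k = recip_sum (greedy_underapprox k \<mu>)" for k
  have S_greedy: "S u (n0 + k) = S u n0 + G k" for k
  proof (cases k)
    case 0
    then show ?thesis by (simp add: G_def recip_sum_def)
  next
    case (Suc j)
    then show ?thesis
      using n0(1)[of "n0 + k"] R_eq_recip_sum[OF n0(2)[of "n0 + k"]]
      by (simp add: R_u \<mu>_def G_def)
  qed
  \<comment> \<open>The hypothesis speaks of maximal sums; differences of consecutive sums recover
    the individual terms of \<open>u\<close>.\<close>
  have greedy_u: "real (u (n + 1)) = of_int \<lfloor>inverse (lam - S u n)\<rfloor> + 1" if n: "n \<ge> n0" for n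
  proof -
    obtain k where k: "n = n0 + k" using le_Suc_ex[OF n] by blast
    have rem: "\<mu> - G k = lam - S u n" unfolding k S_greedy \<mu>_def by simp
    then have "G k < \<mu>" using S_u_less[of n] by simp
    then have "G (Suc k) = G k + 1 / (of_int \<lfloor>inverse (\<mu> - G k)\<rfloor> + 1)"
      unfolding G_def by (rule recip_sum_greedy_Suc)
    then have "1 / real (u (n + 1)) = 1 / (of_int \<lfloor>inverse (lam - S u n)\<rfloor> + 1)"
      using S_greedy[of "Suc k"] S_greedy[of k] S_Suc[of u n] rem k by simp
    then show ?thesis by simp
  qed
  have "S u n0 \<in> \<rat>"
    unfolding S_def by (intro Rats_sum Rats_divide) auto
  then have rat: "lam - S u n0 \<in> \<rat>" using lam by simp
  obtain M where M: "M \<ge> n0" "\<And>n. n \<ge> M \<Longrightarrow> lam - S u n = 1 / (real (u (n + 1)) - 1)"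
      "\<And>n. n \<ge> M \<Longrightarrow> 2 \<le> u (n + 1)"
      "\<And>n. n \<ge> M \<Longrightarrow> u (Suc n + 1) = (u (n + 1))\<^sup>2 - u (n + 1) + 1"
  proof (rule greedy_remainder_eventually_sylvester[of "\<lambda>n. lam - S u n" n0 "\<lambda>n. u (n + 1)"])
    show "0 < lam - S u n" for n using S_u_less[of n] by simp
    show "lam - S u (Suc n) = lam - S u n - 1 / real (u (n + 1))" for n using S_Suc[of u n] by simp
  qed (use rat greedy_u in blast)+

  obtain N where N: "N > 0" "\<And>n. n \<ge> N \<Longrightarrow> a (n + 1) = (a n)\<^sup>2 - a n + 1"
    using a_sylvester unfolding eventually_sylvester_def by blast
  note tail = sylvester_tail[OF a_pos N a_sum]
  have S_a_less: "S a m < lam" for m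
    unfolding S_def sums_unique[OF a_sum] using a_pos a_sum
    by (intro sum_less_suminf) (auto simp: sums_iff)
  \<comment> \<open>\<open>a\<close> need not be monotone, so its initial segment is sorted to
    become admissible.\<close>
  have approx_a: "egyptian_underapprox m lam (sort (map a [1..<m + 1]))" for m
    using S_a_less[of m] a_pos unfolding egyptian_underapprox_def recip_sum_sort recip_sum_map_upt S_def
    by (auto simp del: upt_Suc)
  have S_le: "S a m \<le> S u m" if "m \<ge> 1" for m
  proof -
    have "recip_sum (sort (map a [1..<m + 1])) \<le> recip_sum (map u [1..<m + 1])"
      using best[OF that] approx_a[of m] unfolding best_underapprox_def by blast
    then show ?thesis unfolding recip_sum_sort recip_sum_map_upt S_def .
  qed

  define K where "K = max M N"
  have K: "K \<ge> M" "K \<ge> N" "K \<ge> 1" using N(1) unfolding K_def by auto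
  \<comment> \<open>Equality would make the sorted segment of \<open>a\<close> optimal, hence equal
    to that of \<open>u\<close>. Equal remainders then give \<open>a (K + 1) = u (K + 1)\<close>,
    and the common recursion carries this to all later terms, so the two sets would
    coincide.\<close>
  have S_ne: "S a K \<noteq> S u K"
  proof
    assume eq: "S a K = S u K"
    have "recip_sum (sort (map a [1..<K + 1])) = recip_sum (map u [1..<K + 1])"
      using eq recip_sum_map_upt[of a K] recip_sum_map_upt[of u K]
      unfolding recip_sum_sort S_def by simp
    then have "best_underapprox K lam (sort (map a [1..<K + 1]))"
      using best[OF K(3)] approx_a[of K] unfolding best_underapprox_def by simp
    then have "sort (map a [1..<K + 1]) = map u [1..<K + 1]"
      using unique best[OF K(3)] K(3) by blast
    then have "set (sort (map a [1..<K + 1])) = set (map u [1..<K + 1])" by simp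
    then have init: "a ` {1..<K + 1} = u ` {1..<K + 1}" by (simp only: set_sort set_map set_upt)
    have "1 / (real (a (K + 1)) - 1) = 1 / (real (u (K + 1)) - 1)"
      using M(2)[OF K(1)] tail(2)[OF _ K(2)] eq unfolding S_def by simp
    then have first: "a (K + 1) = u (K + 1)" by simp
    have "a n = u n" if "n \<ge> K + 1" for n
      using that
    proof (induction n rule: dec_induct)
      case (step n)
      then have "n - 1 \<ge> M" "Suc (n - 1) = n" "n \<ge> N" using K by simp_all
      then show ?case using N(2)[of n] M(4)[of "n - 1"] step.IH by simp
    qed (fact first)
    then have "a ` {K + 1..} = u ` {K + 1..}" by (intro image_cong) auto
    moreover have "{1..} = {1..<K + 1} \<union> {K + 1..}" by auto
    ultimately show False using init distinct_sets by (simp only: image_Un)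
  qed
  \<comment> \<open>The smaller partial sum leaves the larger remainder, hence the smaller next
    term; integrality supplies the gap of 1.\<close>
  have less: "real (a (K + 1)) \<le> real (u (K + 1)) - 1"
  proof -
    have "1 / (real (u (K + 1)) - 1) < 1 / (real (a (K + 1)) - 1)"
      using M(2)[OF K(1)] tail(2)[OF _ K(2)] S_ne S_le[OF K(3)] unfolding S_def by simp
    moreover have "2 \<le> a (K + 1)" "2 \<le> u (K + 1)" using tail(1)[of "K + 1"] M(3) K by simp_all
    ultimately have "a (K + 1) < u (K + 1)" by (simp add: divide_simps)
    then show ?thesis by linarith
  qed

  have u_syl: "u (n + 1) = (u n)\<^sup>2 - u n + 1" "2 \<le> u n" if "n \<ge> K + 1" for n
  proof -
    have "n - 1 \<ge> M" "Suc (n - 1) = n" using that K by simp_all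
    then show "u (n + 1) = (u n)\<^sup>2 - u n + 1" "2 \<le> u n" using M(3,4)[of "n - 1"] by simp_all
  qed
  obtain l where l: "(\<lambda>n. real (a n) powr (1 / 2 ^ n)) \<longlonglongrightarrow> l"
      "\<And>n. n \<ge> N \<Longrightarrow> l < real (a n) powr (1 / 2 ^ n)"
    by (rule sylvester_growth[of N a, OF N(2) tail(1)]) blast+
  obtain l' where l': "(\<lambda>n. real (u n) powr (1 / 2 ^ n)) \<longlonglongrightarrow> l'"
      "\<And>n. n \<ge> K + 1 \<Longrightarrow> (real (u n) - 1) powr (1 / 2 ^ n) \<le> l'"
    by (rule sylvester_growth[of "K + 1" u, OF u_syl]) blast+
  \<comment> \<open>The single index \<open>K + 1\<close> suffices: the strict upper bound for
    \<open>a\<close> meets the lower bound for \<open>u\<close> there.\<close>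
  have "l < real (a (K + 1)) powr (1 / 2 ^ (K + 1))" using l(2)[of "K + 1"] K by simp
  also have "\<dots> \<le> (real (u (K + 1)) - 1) powr (1 / 2 ^ (K + 1))"
    using less by (intro powr_mono2) auto
  also have "\<dots> \<le> l'" using l'(2)[of "K + 1"] by simp
  finally have "l < l'" .
  moreover have "liminf (\<lambda>n. ereal (real (a n) powr (1 / 2 ^ n))) = ereal l"
    using l(1) by (intro lim_imp_Liminf) auto
  ultimately show ?thesis
    using convergentI[OF l(1)] convergentI[OF l'(1)] limI[OF l(1)] limI[OF l'(1)] by simp
qed

end
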